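(* Assume the set $\Sigma$ of saddle points of $L$ is non-empty and let $(x,y,\lambda):[0,+\infty)\to X\times Y\times Z$ be a solution of the generalized Arrow--Hurwicz differential system (GAH). Then, for any $(\xi,\psi,\eta)\in\Sigma$: (i) $\lim_{t\to+\infty}\|(x(t),y(t),\lambda(t))-(\xi,\psi,\eta)\|$ exists; (ii) $\lim_{t\to+\infty}\|(\dot x(t),\dot y(t),\dot\lambda(t))\|$ exists; (iii) it holds that $$\int_0^\infty L(x(\tau),y(\tau),\eta)-L(\xi,\psi,\lambda(\tau))\,\mathrm d\tau<+\infty .$$
   Context: $X$, $Y$, $Z$ are real Hilbert spaces; $X\times Y\times Z$ carries the product Hilbert structure $\langle\cdot,\cdot\rangle=\langle\cdot,\cdot\rangle_X+\langle\cdot,\cdot\rangle_Y+\langle\cdot,\cdot\rangle_Z$, with norm $\|\cdot\|$. Standing assumptions: $f:X\to\mathbb R$ and $g:Y\to\mathbb R$ are convex and continuously differentiable; $\nabla f:X\to X$ and $\nabla g:Y\to Y$ are Lipschitz continuous on bounded sets; $A:X\to Z$ and $B:Y\to Z$ are linear and continuous, with adjoints $A^*,B^*$; $c\in Z$. The Lagrangian is $L:X\times Y\times Z\to\mathbb R$, $L(x,y,\lambda)=f(x)+g(y)+\langle\lambda,Ax+By-c\rangle_Z$. A saddle point of $L$ is a triple $(\bar x,\bar y,\bar\lambda)\in X\times Y\times Z$ with $L(\bar x,\bar y,\lambda)\le L(\bar x,\bar y,\bar\lambda)\le L(x,y,\bar\lambda)$ for all $(x,y,\lambda)\in X\times Y\times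 Z$; $\Sigma\subset X\times Y\times Z$ denotes the set of all saddle points of $L$. The system (GAH) is $$\dot x+\nabla f(x)+A^*\lambda=0_X,\qquad \dot y+\nabla g(y)+B^*\lambda=0_Y,\qquad \dot\lambda+c-Ax-By=0_Z,$$ with initial data $(x(0),y(0),\lambda(0))=(x_0,y_0,\lambda_0)\in X\times Y\times Z$; a solution is a function of class $\mathcal C^1$ on $[0,+\infty)$ with values in $X\times Y\times Z$ satisfying the system on $[0,+\infty)$ with these initial data. *)

theory Defs
  imports "HOL-Analysis.Analysis"
begin

text \<open>
  A real Hilbert space is a type of sort \<open>{real_inner, complete_space}\<close>. The product types carry the
  product Hilbert structure, and \<^const>\<open>norm\<close> on \<open>'x \<times> 'y \<times> 'z\<close> is the associated norm. The adjoint
  of a bounded linear operator is the library's \<^const>\<open>adjoint\<close>; its defining choice is well-founded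
  between Hilbert spaces by the Riesz representation theorem.
\<close>

definition continuously_differentiable :: "('a::real_normed_vector \<Rightarrow> real) \<Rightarrow> bool" where
  "continuously_differentiable f \<longleftrightarrow>
     (\<exists>f' :: 'a \<Rightarrow> 'a \<Rightarrow>\<^sub>L real.
        (\<forall>x. (f has_derivative blinfun_apply (f' x)) (at x)) \<and> continuous_on UNIV f')"

text \<open>
  The Riesz representative of the Frechet derivative. It exists and is unique at every point of
  differentiability of a function on a Hilbert space.
\<close>

definition gradient :: "('a::real_inner \<Rightarrow> real) \<Rightarrow> 'a \<Rightarrow> 'a" where
  "gradient f x = (THE D. GDERIV f x :> D)"

definition lipschitz_on_bounded_sets :: "('a::metric_space \<Rightarrow> 'b::metric_space) \<Rightarrow> bool" where
  "lipschitz_on_bounded_sets F \<longleftrightarrow> (\<forall>S. bounded S \<longrightarrow> (\<exists>C. C-lipschitz_on S F))"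

definition Lagrangian ::
  "('x \<Rightarrow> real) \<Rightarrow> ('y \<Rightarrow> real) \<Rightarrow> ('x \<Rightarrow> 'z) \<Rightarrow> ('y \<Rightarrow> 'z) \<Rightarrow> 'z \<Rightarrow>
   'x \<Rightarrow> 'y \<Rightarrow> 'z::real_inner \<Rightarrow> real" where
  "Lagrangian f g A B c x y lam = f x + g y + lam \<bullet> (A x + B y - c)"

definition saddle_points :: "('x \<Rightarrow> 'y \<Rightarrow> 'z \<Rightarrow> real) \<Rightarrow> ('x \<times> 'y \<times> 'z) set" where
  "saddle_points L =
     {(x', y', lam'). \<forall>x y lam. L x' y' lam \<le> L x' y' lam' \<and> L x' y' lam' \<le> L x y lam'}"

text \<open>
  Time derivative of a curve on the half-line; at \<open>0\<close> it is the one-sided derivative. Curves are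
  total functions on \<^typ>\<open>real\<close>, but only their values on \<open>{0..}\<close> matter.
\<close>

definition dot :: "(real \<Rightarrow> 'a::real_normed_vector) \<Rightarrow> real \<Rightarrow> 'a" where
  "dot u t = vector_derivative u (at t within {0..})"

definition C1_on_halfline :: "(real \<Rightarrow> 'a::real_normed_vector) \<Rightarrow> bool" where
  "C1_on_halfline u \<longleftrightarrow> u differentiable_on {0..} \<and> continuous_on {0..} (dot u)"

definition GAH_solution ::
  "('x::{real_inner, complete_space} \<Rightarrow> real) \<Rightarrow> ('y::{real_inner, complete_space} \<Rightarrow> real) \<Rightarrow>
   ('x \<Rightarrow> 'z::{real_inner, complete_space}) \<Rightarrow> ('y \<Rightarrow> 'z) \<Rightarrow> 'z \<Rightarrow>
   'x \<Rightarrow> 'y \<Rightarrow> 'z \<Rightarrow> (real \<Rightarrow> 'x) \<Rightarrow> (real \<Rightarrow> 'y) \<Rightarrow> (real \<Rightarrow> 'z) \<Rightarrow> bool" where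
  "GAH_solution f g A B c x0 y0 lam0 x y lam \<longleftrightarrow>
     C1_on_halfline (\<lambda>t. (x t, y t, lam t)) \<and>
     x 0 = x0 \<and> y 0 = y0 \<and> lam 0 = lam0 \<and>
     (\<forall>t\<ge>0. dot x t + gradient f (x t) + adjoint A (lam t) = 0 \<and>
            dot y t + gradient g (y t) + adjoint B (lam t) = 0 \<and>
            dot lam t + c - A (x t) - B (y t) = 0)"

end

theory Submission
  imports Defs
begin

text \<open>
  Write \<open>u = (x, y, lam)\<close>. In the dissipation of \<open>(norm (u t - (\<xi>, \<psi>, \<eta>)))\<^sup>2 / 2\<close> along the
  flow the coupling terms in \<open>A\<close> and \<open>B\<close> are skew, and the gradient inequality for \<open>f\<close> and \<open>g\<close>
  bounds its derivative above by minus the (nonnegative) duality gap; so the distance decreases and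
  the gap is dominated by an integrable derivative. For the same reason the vector field is
  dissipative, so \<open>norm (u (t + h) - u t)\<close> decreases in \<open>t\<close> for each \<open>h > 0\<close>; dividing by \<open>h\<close> and
  letting \<open>h\<close> tend to 0, the speed decreases. Gradients and adjoints come from the Riesz
  representation theorem, proved by minimising \<open>v \<bullet> v - 2 * \<phi> v\<close>.
\<close>

lemma riesz_representation:
  fixes \<phi> :: "'a::{real_inner, complete_space} \<Rightarrow> real"
  assumes "bounded_linear \<phi>"
  obtains w where "\<And>x. \<phi> x = x \<bullet> w"
proof -
  interpret bounded_linear \<phi> by fact
  define J where "J v = v \<bullet> v - 2 * \<phi> v" for v
  obtain K where K: "\<And>v. norm (\<phi> v) \<le> norm v * K"
    using bounded by blast
  have J_lower: "- K\<^sup>2 \<le> J v" for v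
  proof -
    have "\<phi> v \<le> norm v * K"
      using K[of v] by simp
    moreover have "0 \<le> (norm v - K)\<^sup>2"
      by simp
    ultimately show ?thesis
      by (simp add: J_def dot_square_norm power2_diff)
  qed
  then have bdd: "bdd_below (range J)"
    by (intro bdd_belowI2)
  define m where "m = Inf (range J)"
  have m_le: "m \<le> J v" for v
    unfolding m_def by (intro cInf_lower bdd) simp
  have "\<exists>v. J v < m + 1 / Suc n" for n
    using cInf_lessD[of "range J" "m + 1 / Suc n"] by (auto simp: m_def)
  then obtain a where a: "\<And>n. J (a n) < m + 1 / Suc n"
    by metis
  \<comment> \<open>The parallelogram identity makes every minimising sequence of \<open>J\<close> Cauchy.\<close>
  have dist_bound: "(norm (v - w))\<^sup>2 \<le> 2 * (J v - m) + 2 * (J w - m)" for v w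
  proof -
    have "J v + J w = 2 * J ((1/2) *\<^sub>R (v + w)) + (norm (v - w))\<^sup>2 / 2"
      unfolding power2_norm_eq_inner J_def
      by (simp add: algebra_simps scaleR add inner_commute[of w v] add_divide_distrib diff_divide_distrib)
    then show ?thesis
      using m_le[of "(1/2) *\<^sub>R (v + w)"] by simp
  qed
  have "Cauchy a"
  proof (rule metric_CauchyI)
    fix e :: real
    assume "0 < e"
    obtain N where N: "4 / e\<^sup>2 < real N"
      using reals_Archimedean2 by blast
    have "dist (a i) (a j) < e" if "N \<le> i" "N \<le> j" for i j
    proof -
      have small: "J (a k) - m < e\<^sup>2 / 4" if "N \<le> k" for k
      proof -
        have "4 / e\<^sup>2 < real (Suc k)"
          using N that by simp
        then have "1 / real (Suc k) < e\<^sup>2 / 4"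
          using \<open>0 < e\<close> by (simp add: field_simps)
        then show ?thesis
          using a[of k] by simp
      qed
      have "(norm (a i - a j))\<^sup>2 < e\<^sup>2"
        using dist_bound[of "a i" "a j"] small[OF that(1)] small[OF that(2)] by simp
      then show ?thesis
        using \<open>0 < e\<close> by (simp add: dist_norm power2_less_imp_less)
    qed
    then show "\<exists>N. \<forall>i\<ge>N. \<forall>j\<ge>N. dist (a i) (a j) < e"
      by blast
  qed
  then obtain w where w: "a \<longlonglongrightarrow> w"
    using Cauchy_convergent convergentD by blast
  have "(\<lambda>n. J (a n)) \<longlonglongrightarrow> J w"
    unfolding J_def by (intro tendsto_intros tendsto w)
  moreover have "(\<lambda>n. m + 1 / real (Suc n)) \<longlonglongrightarrow> m + 0"
    by (intro tendsto_intros LIMSEQ_Suc[OF lim_1_over_n])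
  ultimately have "J w \<le> m + 0"
    by (rule LIMSEQ_le) (use a less_imp_le in blast)
  then have min: "J w \<le> J v" for v
    using m_le[of v] by simp
  have "\<phi> h = h \<bullet> w" for h
  proof -
    have "(J has_derivative (\<lambda>h. w \<bullet> h + h \<bullet> w - 2 * \<phi> h)) (at w)"
      unfolding J_def by (auto intro!: derivative_eq_intros has_derivative)
    then have "(\<lambda>h. w \<bullet> h + h \<bullet> w - 2 * \<phi> h) = (\<lambda>h. 0)"
      by (rule differential_zero_maxmin[where S = UNIV, rotated 2]) (use min in auto)
    from fun_cong[OF this, of h] show ?thesis
      by (simp add: inner_commute)
  qed
  then show ?thesis
    by (rule that)
qed

lemma adjoint_inner_right:
  fixes A :: "'a::{real_inner, complete_space} \<Rightarrow> 'b::real_inner"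
  assumes "bounded_linear A"
  shows "v \<bullet> adjoint A w = A v \<bullet> w"
proof -
  have "\<exists>u. \<forall>v. A v \<bullet> w = v \<bullet> u" for w
  proof -
    have "bounded_linear (\<lambda>v. A v \<bullet> w)"
      using assms by (rule bounded_linear_inner_left_comp)
    then show ?thesis
      using riesz_representation by metis
  qed
  then obtain A' where "\<forall>v w. A v \<bullet> w = v \<bullet> A' w"
    by metis
  then show ?thesis
    using adjoint_unique by metis
qed

lemma GDERIV_unique:
  assumes "GDERIV f x :> D" "GDERIV f x :> E"
  shows "D = E"
proof -
  have "(\<lambda>h. h \<bullet> D) = (\<lambda>h. h \<bullet> E)"
    using assms unfolding gderiv_def by (rule has_derivative_unique)
  then show ?thesis
    by (metis vector_eq_ldot)
qed

lemma GDERIV_gradient: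
  fixes f :: "'a::{real_inner, complete_space} \<Rightarrow> real"
  assumes "(f has_derivative f') (at x)"
  shows "GDERIV f x :> gradient f x"
proof -
  obtain D where "\<And>h. f' h = h \<bullet> D"
    using riesz_representation[OF has_derivative_bounded_linear[OF assms]] by metis
  then have "f' = (\<lambda>h. h \<bullet> D)"
    by (rule ext)
  then have "GDERIV f x :> D"
    using assms by (simp add: gderiv_def)
  then show ?thesis
    unfolding gradient_def by (rule theI) (rule GDERIV_unique[OF _ \<open>GDERIV f x :> D\<close>])
qed

lemma convex_on_imp_above_tangent_gradient:
  assumes "convex_on UNIV f" "GDERIV f x :> D"
  shows "f x + (y - x) \<bullet> D \<le> f y"
proof -
  define \<phi> where "\<phi> s = f (x + s *\<^sub>R (y - x))" for s
  have "convex_on UNIV \<phi>"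
  proof (rule convex_onI)
    fix t r s :: real
    assume t: "0 < t" "t < 1"
    have "x + ((1 - t) *\<^sub>R r + t *\<^sub>R s) *\<^sub>R (y - x)
        = (1 - t) *\<^sub>R (x + r *\<^sub>R (y - x)) + t *\<^sub>R (x + s *\<^sub>R (y - x))"
      by (simp add: algebra_simps)
    then show "\<phi> ((1 - t) *\<^sub>R r + t *\<^sub>R s) \<le> (1 - t) * \<phi> r + t * \<phi> s"
      unfolding \<phi>_def using convex_onD[OF assms(1), of t] t by simp
  qed simp
  moreover have "(\<phi> has_field_derivative (y - x) \<bullet> D) (at 0)"
  proof -
    have "(f has_derivative (\<lambda>h. h \<bullet> D)) (at (x + 0 *\<^sub>R (y - x)))"
      using assms(2) by (simp add: gderiv_def)
    moreover have "((\<lambda>s. x + s *\<^sub>R (y - x)) has_derivative (\<lambda>s. s *\<^sub>R (y - x))) (at 0)"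
      by (auto intro!: derivative_eq_intros)
    ultimately have "(\<phi> has_derivative (\<lambda>s. (s *\<^sub>R (y - x)) \<bullet> D)) (at 0)"
      unfolding \<phi>_def using has_derivative_compose by fast
    then show ?thesis
      by (simp add: has_field_derivative_def mult_commute_abs)
  qed
  ultimately have "\<phi> 1 - \<phi> 0 \<ge> ((y - x) \<bullet> D) * (1 - 0)"
    by (intro convex_on_imp_above_tangent[where A = UNIV]) auto
  then show ?thesis
    by (simp add: \<phi>_def)
qed

lemma gradient_monotone:
  assumes "convex_on UNIV f" "GDERIV f x :> D" "GDERIV f y :> E"
  shows "0 \<le> (y - x) \<bullet> (E - D)"
  using convex_on_imp_above_tangent_gradient[OF assms(1,2), of y]
    convex_on_imp_above_tangent_gradient[OF assms(1,3), of x]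
  by (simp add: inner_diff_left inner_diff_right)

lemma antimono_on_imp_tendsto_at_top:
  fixes h :: "real \<Rightarrow> real"
  assumes "antimono_on {a..} h" and "\<And>t. a \<le> t \<Longrightarrow> b \<le> h t"
  shows "\<exists>l. (h \<longlongrightarrow> l) at_top"
proof (intro exI, rule decreasing_tendsto)
  have bdd: "bdd_below (h ` {a..})"
    using assms(2) by (intro bdd_belowI2[where m = b]) simp
  show "\<forall>\<^sub>F t in at_top. Inf (h ` {a..}) \<le> h t"
    using eventually_ge_at_top[of a] by eventually_elim (auto intro: cInf_lower bdd)
  fix r
  assume "Inf (h ` {a..}) < r"
  then obtain s where "a \<le> s" "h s < r"
    using cInf_lessD[of "h ` {a..}" r] by auto
  then have "h t < r" if "s \<le> t" for t
    using monotone_onD[OF assms(1), of s t] that by simp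
  then show "\<forall>\<^sub>F t in at_top. h t < r"
    unfolding eventually_at_top_linorder by blast
qed

lemma has_real_derivative_half_norm_square:
  fixes u :: "real \<Rightarrow> 'a::real_inner"
  assumes "(u has_vector_derivative u') (at t within S)"
  shows "((\<lambda>t. (norm (u t))\<^sup>2 / 2) has_real_derivative u' \<bullet> u t) (at t within S)"
  using assms unfolding has_vector_derivative_def has_field_derivative_def power2_norm_eq_inner
  by (auto intro!: derivative_eq_intros simp: inner_commute)

lemma antimono_on_halfline_if_deriv_nonpos:
  fixes h :: "real \<Rightarrow> real"
  assumes "\<And>t. a \<le> t \<Longrightarrow> (h has_real_derivative h' t) (at t within {a..})"
    and "\<And>t. a \<le> t \<Longrightarrow> h' t \<le> 0"
  shows "antimono_on {a..} h"
proof (rule monotone_onI)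
  fix s t :: real
  assume st: "s \<in> {a..}" "t \<in> {a..}" "s \<le> t"
  show "h t \<le> h s"
  proof (rule DERIV_nonpos_imp_decreasing_open[OF st(3)])
    show "continuous_on {s..t} h"
      by (rule continuous_on_subset[of "{a..}"])
        (use st assms(1) in \<open>auto intro: DERIV_continuous_on\<close>)
    fix r
    assume "s < r" "r < t"
    then have "a < r"
      using st(1) by simp
    then have "(h has_real_derivative h' r) (at r)"
      using assms(1)[of r] at_within_interior[of r "{a..}"] by simp
    then show "\<exists>y. (h has_real_derivative y) (at r) \<and> y \<le> 0"
      using assms(2)[of r] \<open>a < r\<close> by auto
  qed
qed

lemma antimono_on_speed_of_dissipative_curve:
  fixes u v :: "real \<Rightarrow> 'a::real_inner"
  assumes deriv: "\<And>t. 0 \<le> t \<Longrightarrow> (u has_vector_derivative v t) (at t within {0..})"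
    and dissip: "\<And>s t. 0 \<le> s \<Longrightarrow> 0 \<le> t \<Longrightarrow> (v s - v t) \<bullet> (u s - u t) \<le> 0"
  shows "antimono_on {0..} (\<lambda>t. norm (v t))"
proof -
  have shift: "antimono_on {0..} (\<lambda>t. (norm (u (t + h) - u t))\<^sup>2 / 2)" if "0 \<le> h" for h
  proof (rule antimono_on_halfline_if_deriv_nonpos)
    fix t :: real
    assume "0 \<le> t"
    have "((\<lambda>s. s + h) has_real_derivative 1) (at t within {0..})"
      by (auto intro!: derivative_eq_intros)
    moreover have "(u has_vector_derivative v (t + h)) (at (t + h) within (\<lambda>s. s + h) ` {0..})"
      using that \<open>0 \<le> t\<close> by (intro has_vector_derivative_within_subset[OF deriv]) auto
    ultimately have "((u \<circ> (\<lambda>s. s + h)) has_vector_derivative 1 *\<^sub>R v (t + h)) (at t within {0..})"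
      unfolding has_real_derivative_iff_has_vector_derivative
      by (rule vector_diff_chain_within)
    then have "((\<lambda>s. u (s + h) - u s) has_vector_derivative v (t + h) - v t) (at t within {0..})"
      using deriv[OF \<open>0 \<le> t\<close>] by (auto simp: o_def intro: has_vector_derivative_diff)
    then show "((\<lambda>t. (norm (u (t + h) - u t))\<^sup>2 / 2) has_real_derivative
        (v (t + h) - v t) \<bullet> (u (t + h) - u t)) (at t within {0..})"
      by (rule has_real_derivative_half_norm_square)
    show "(v (t + h) - v t) \<bullet> (u (t + h) - u t) \<le> 0"
      using dissip[of "t + h" t] that \<open>0 \<le> t\<close> by simp
  qed
  have lim: "((\<lambda>h. norm ((1 / h) *\<^sub>R (u (t + h) - u t))) \<longlongrightarrow> norm (v t)) (at_right 0)"
    if "0 \<le> t" for t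
  proof -
    have "(u has_vector_derivative v t) (at t within {t..})"
      using that by (intro has_vector_derivative_within_subset[OF deriv]) auto
    then have "((\<lambda>s. norm (u s - u t - (s - t) *\<^sub>R v t) / norm (s - t)) \<longlongrightarrow> 0) (at_right t)"
      unfolding has_vector_derivative_def has_derivative_iff_norm
      by (auto intro: tendsto_within_subset)
    moreover have "\<forall>\<^sub>F s in at_right t. norm (u s - u t - (s - t) *\<^sub>R v t) / norm (s - t)
        = norm ((1 / (s - t)) *\<^sub>R (u s - u t) - v t)"
    proof -
      have "norm (u s - u t - (s - t) *\<^sub>R v t) / norm (s - t)
          = norm ((1 / (s - t)) *\<^sub>R (u s - u t) - v t)" if "t < s" for s
      proof -
        have "(1 / (s - t)) *\<^sub>R (u s - u t - (s - t) *\<^sub>R v t) = (1 / (s - t)) *\<^sub>R (u s - u t) - v t"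
          using that by (simp add: scaleR_diff_right)
        then show ?thesis
          using that by (metis norm_scaleR norm_divide norm_one divide_inverse mult.commute
              mult_1 real_norm_def)
      qed
      then show ?thesis
        by (simp add: eventually_at_filter)
    qed
    ultimately have "((\<lambda>s. norm ((1 / (s - t)) *\<^sub>R (u s - u t) - v t)) \<longlongrightarrow> 0) (at_right t)"
      by (rule Lim_transform_eventually)
    then have "((\<lambda>s. (1 / (s - t)) *\<^sub>R (u s - u t)) \<longlongrightarrow> v t) (at_right t)"
      by (simp add: tendsto_norm_zero_iff flip: Lim_null)
    then have "((\<lambda>h. (1 / h) *\<^sub>R (u (t + h) - u t)) \<longlongrightarrow> v t) (at_right 0)"
      by (subst (asm) filterlim_at_right_to_0) (simp add: add.commute)
    then show ?thesis
      by (rule tendsto_norm)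
  qed
  show ?thesis
  proof (rule monotone_onI)
    fix s t :: real
    assume st: "s \<in> {0..}" "t \<in> {0..}" "s \<le> t"
    have "norm ((1 / h) *\<^sub>R (u (t + h) - u t)) \<le> norm ((1 / h) *\<^sub>R (u (s + h) - u s))"
      if "0 < h" for h
      using monotone_onD[OF shift st] that
      by (auto simp: divide_right_mono intro: power2_le_imp_le)
    then have "\<forall>\<^sub>F h in at_right 0. norm ((1 / h) *\<^sub>R (u (t + h) - u t))
        \<le> norm ((1 / h) *\<^sub>R (u (s + h) - u s))"
      by (auto simp: eventually_at_filter)
    then show "norm (v t) \<le> norm (v s)"
      using st by (intro tendsto_le[OF _ lim lim]) auto
  qed
qed

lemma set_integrable_dissipation_rate:
  fixes V V' p :: "real \<Rightarrow> real"
  assumes deriv: "\<And>t. 0 \<le> t \<Longrightarrow> (V has_real_derivative V' t) (at t within {0..})"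
    and "continuous_on {0..} V'" and "continuous_on {0..} p"
    and p: "\<And>t. 0 \<le> t \<Longrightarrow> 0 \<le> p t" "\<And>t. 0 \<le> t \<Longrightarrow> p t \<le> - V' t"
    and lim: "(V \<longlongrightarrow> l) at_top"
  shows "set_integrable lborel {0..} p"
proof -
  have V'_nonpos: "V' t \<le> 0" if "0 \<le> t" for t
    using p[OF that] by simp
  have deriv_at: "(V has_real_derivative V' t) (at t)" if "0 < t" for t
    using deriv[of t] at_within_interior[of t "{0..}"] that by simp
  have isCont: "isCont V' t" if "0 < t" for t
    by (rule continuous_on_interior[OF assms(2)]) (use that in simp)
  have "(V \<longlongrightarrow> V 0) (at 0 within {0..})"
    using DERIV_continuous[OF deriv[OF order_refl]] unfolding continuous_within .
  then have lim0: "(V \<longlongrightarrow> V 0) (at_right 0)"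
    by (rule tendsto_within_subset) auto
  have "set_integrable lborel (einterval (ereal 0) \<infinity>) (\<lambda>t. - V' t)"
  proof (rule interval_integral_FTC_nonneg(1)[where F = "\<lambda>t. - V t"])
    show "(((\<lambda>t. - V t) \<circ> real_of_ereal) \<longlongrightarrow> - V 0) (at_right (ereal 0))"
      unfolding ereal_tendsto_simps by (intro tendsto_minus lim0)
    show "(((\<lambda>t. - V t) \<circ> real_of_ereal) \<longlongrightarrow> - l) (at_left \<infinity>)"
      unfolding ereal_tendsto_simps by (intro tendsto_minus lim)
    show "AE t in lborel. ereal 0 < ereal t \<longrightarrow> ereal t < \<infinity> \<longrightarrow> 0 \<le> - V' t"
      using V'_nonpos by (intro AE_I2) auto
  qed (use deriv_at isCont in \<open>auto intro: DERIV_minus\<close>)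
  then have "set_integrable lborel {0<..} (\<lambda>t. - V' t)"
    by (simp add: einterval_eq)
  then have "integrable lborel (\<lambda>t. indicator {0..} t *\<^sub>R (- V' t))"
    unfolding set_integrable_def
    by (rule integrable_discrete_difference[where X = "{0}", THEN iffD1, rotated -1])
      (auto simp: indicator_def)
  then show ?thesis
    unfolding set_integrable_def
  proof (rule Bochner_Integration.integrable_bound)
    show "(\<lambda>t. indicator {0..} t *\<^sub>R p t) \<in> borel_measurable lborel"
      using borel_measurable_continuous_on_indicator[of "{0..}" p] assms(3) by simp
    have "norm (p t) \<le> norm (- V' t)" if "0 \<le> t" for t
      using p[OF that] by simp
    then show "AE t in lborel. norm (indicator {0..} t *\<^sub>R p t)
        \<le> norm (indicator {0..} t *\<^sub>R - V' t)"
      by (intro AE_I2) (simp add: indicator_def)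
  qed
qed

lemma C1_on_halfline_dot:
  assumes "C1_on_halfline u" "0 \<le> t"
  shows "(u has_vector_derivative dot u t) (at t within {0..})"
  using assms unfolding C1_on_halfline_def dot_def differentiable_on_def
  by (auto simp: vector_derivative_works)

lemma dot_eqI:
  assumes "(u has_vector_derivative u') (at t within {0..})" "0 \<le> t"
  shows "dot u t = u'"
proof -
  have "at_right t \<le> at t within {0..}"
    using assms(2) by (intro at_le) auto
  then have "at t within {0..} \<noteq> bot"
    using trivial_limit_at_right_real[of t] by (metis le_bot)
  then show ?thesis
    unfolding dot_def using assms(1) by (rule vector_derivative_within)
qed

lemma dot_Pair:
  assumes "((\<lambda>t. (u t, v t)) has_vector_derivative w) (at t within {0..})" "0 \<le> t"
  shows "dot u t = fst w" and "dot v t = snd w"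
proof -
  show "dot u t = fst w"
    using bounded_linear.has_vector_derivative[OF bounded_linear_fst assms(1)] assms(2)
    by (intro dot_eqI) auto
  show "dot v t = snd w"
    using bounded_linear.has_vector_derivative[OF bounded_linear_snd assms(1)] assms(2)
    by (intro dot_eqI) auto
qed

theorem theorem5p1:
  fixes f :: "'x::{real_inner, complete_space} \<Rightarrow> real"
    and g :: "'y::{real_inner, complete_space} \<Rightarrow> real"
    and A :: "'x \<Rightarrow> 'z::{real_inner, complete_space}"
    and B :: "'y \<Rightarrow> 'z"
    and c :: 'z
    and x0 :: 'x and y0 :: 'y and lam0 :: 'z
    and x :: "real \<Rightarrow> 'x" and y :: "real \<Rightarrow> 'y" and lam :: "real \<Rightarrow> 'z"
  assumes "convex_on UNIV f" and "convex_on UNIV g"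
    and "continuously_differentiable f" and "continuously_differentiable g"
    and "lipschitz_on_bounded_sets (gradient f)" and "lipschitz_on_bounded_sets (gradient g)"
    and "bounded_linear A" and "bounded_linear B"
    and "saddle_points (Lagrangian f g A B c) \<noteq> {}"
    and "GAH_solution f g A B c x0 y0 lam0 x y lam"
  shows "\<forall>(\<xi>, \<psi>, \<eta>) \<in> saddle_points (Lagrangian f g A B c).
      (\<exists>l. ((\<lambda>t. norm ((x t, y t, lam t) - (\<xi>, \<psi>, \<eta>))) \<longlongrightarrow> l) at_top) \<and>
      (\<exists>l. ((\<lambda>t. norm (dot x t, dot y t, dot lam t)) \<longlongrightarrow> l) at_top) \<and>
      set_integrable lborel {0..}
        (\<lambda>\<tau>. Lagrangian f g A B c (x \<tau>) (y \<tau>) \<eta> - Lagrangian f g A B c \<xi> \<psi> (lam \<tau>))"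
proof clarify
  fix \<xi> \<psi> \<eta>
  assume saddle: "(\<xi>, \<psi>, \<eta>) \<in> saddle_points (Lagrangian f g A B c)"
  let ?L = "Lagrangian f g A B c"
  interpret A: bounded_linear A by fact
  interpret B: bounded_linear B by fact
  have grad_f: "GDERIV f v :> gradient f v" for v
    using assms(3) unfolding continuously_differentiable_def by (blast intro: GDERIV_gradient)
  have grad_g: "GDERIV g v :> gradient g v" for v
    using assms(4) unfolding continuously_differentiable_def by (blast intro: GDERIV_gradient)
  define u where "u t = (x t, y t, lam t)" for t
  have C1: "C1_on_halfline u"
    using assms(10) unfolding GAH_solution_def u_def[abs_def] by blast
  note deriv_u = C1_on_halfline_dot[OF C1]
  have cont_u: "continuous_on {0..} u" and cont_dot: "continuous_on {0..} (dot u)"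
    using C1 differentiable_imp_continuous_on unfolding C1_on_halfline_def by blast+
  have dot_u: "dot u t = (dot x t, dot y t, dot lam t)" if "0 \<le> t" for t
  proof -
    have deriv: "((\<lambda>t. (x t, y t, lam t)) has_vector_derivative dot u t) (at t within {0..})"
      using deriv_u[OF that] by (simp add: u_def[abs_def])
    then have "((\<lambda>t. (y t, lam t)) has_vector_derivative snd (dot u t)) (at t within {0..})"
      using bounded_linear.has_vector_derivative[OF bounded_linear_snd] by fastforce
    from dot_Pair[OF deriv that] dot_Pair[OF this that] show ?thesis
      by (metis prod.collapse)
  qed
  have GAH: "dot x t = - gradient f (x t) - adjoint A (lam t)"
      "dot y t = - gradient g (y t) - adjoint B (lam t)"
      "dot lam t = A (x t) + B (y t) - c" if "0 \<le> t" for t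
    using assms(10) that unfolding GAH_solution_def
    by (auto simp: algebra_simps eq_neg_iff_add_eq_0)
  note adj = adjoint_inner_right[OF \<open>bounded_linear A\<close>] adjoint_inner_right[OF \<open>bounded_linear B\<close>]

  have "antimono_on {0..} (\<lambda>t. norm (dot u t))"
  proof (rule antimono_on_speed_of_dissipative_curve[OF deriv_u])
    fix s t :: real
    assume "0 \<le> s" "0 \<le> t"
    have "(dot u s - dot u t) \<bullet> (u s - u t)
        = - ((x s - x t) \<bullet> (gradient f (x s) - gradient f (x t)))
          - (y s - y t) \<bullet> (gradient g (y s) - gradient g (y t))"
      unfolding dot_u[OF \<open>0 \<le> s\<close>] dot_u[OF \<open>0 \<le> t\<close>] u_def GAH[OF \<open>0 \<le> s\<close>] GAH[OF \<open>0 \<le> t\<close>]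
      by (simp add: inner_diff_left inner_diff_right inner_add_left inner_add_right
          inner_commute[of "adjoint _ _"] adj inner_commute[of "gradient _ _"]
          inner_commute[of "lam _"])
    also have "\<dots> \<le> 0"
      using gradient_monotone[OF assms(1) grad_f[of "x t"] grad_f[of "x s"]]
        gradient_monotone[OF assms(2) grad_g[of "y t"] grad_g[of "y s"]]
      by simp
    finally show "(dot u s - dot u t) \<bullet> (u s - u t) \<le> 0" .
  qed
  then have "\<exists>l. ((\<lambda>t. norm (dot u t)) \<longlongrightarrow> l) at_top"
    by (rule antimono_on_imp_tendsto_at_top) (rule norm_ge_zero)
  moreover have "\<forall>\<^sub>F t in at_top. norm (dot u t) = norm (dot x t, dot y t, dot lam t)"
    using eventually_ge_at_top[of 0] by eventually_elim (simp add: dot_u)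
  ultimately have speed: "\<exists>l. ((\<lambda>t. norm (dot x t, dot y t, dot lam t)) \<longlongrightarrow> l) at_top"
    by (auto intro: Lim_transform_eventually)

  define gap where "gap t = ?L (x t) (y t) \<eta> - ?L \<xi> \<psi> (lam t)" for t
  define V where "V t = (norm (u t - (\<xi>, \<psi>, \<eta>)))\<^sup>2 / 2" for t
  define V' where "V' t = dot u t \<bullet> (u t - (\<xi>, \<psi>, \<eta>))" for t
  have gap_nonneg: "0 \<le> gap t" for t
  proof -
    have "?L \<xi> \<psi> (lam t) \<le> ?L \<xi> \<psi> \<eta>" "?L \<xi> \<psi> \<eta> \<le> ?L (x t) (y t) \<eta>"
      using saddle unfolding saddle_points_def by auto
    then show ?thesis
      by (simp add: gap_def)
  qed
  have gap_le: "gap t \<le> - V' t" if "0 \<le> t" for t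
  proof -
    have "- V' t - gap t = (f \<xi> - f (x t) - (\<xi> - x t) \<bullet> gradient f (x t))
        + (g \<psi> - g (y t) - (\<psi> - y t) \<bullet> gradient g (y t))"
      unfolding V'_def gap_def Lagrangian_def dot_u[OF that] u_def GAH[OF that]
      by (simp add: inner_diff_left inner_diff_right inner_add_left inner_add_right
          inner_commute[of "adjoint _ _"] adj inner_commute[of "gradient _ _"]
          inner_commute[of "lam _"] inner_commute[of \<eta>])
    then show ?thesis
      using convex_on_imp_above_tangent_gradient[OF assms(1) grad_f, of "x t" \<xi>]
        convex_on_imp_above_tangent_gradient[OF assms(2) grad_g, of "y t" \<psi>]
      by simp
  qed
  have deriv_V: "(V has_real_derivative V' t) (at t within {0..})" if "0 \<le> t" for t
  proof -
    have "((\<lambda>t. u t - (\<xi>, \<psi>, \<eta>)) has_vector_derivative dot u t) (at t within {0..})"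
      using has_vector_derivative_diff[OF deriv_u[OF that] has_vector_derivative_const] by simp
    then show ?thesis
      unfolding V_def V'_def by (rule has_real_derivative_half_norm_square)
  qed
  have "V' t \<le> 0" if "0 \<le> t" for t
    using gap_le[OF that] gap_nonneg[of t] by simp
  with deriv_V have "antimono_on {0..} V"
    by (rule antimono_on_halfline_if_deriv_nonpos)
  then obtain l where l: "(V \<longlongrightarrow> l) at_top"
    using antimono_on_imp_tendsto_at_top[of 0 V 0] by (auto simp: V_def)
  then have "((\<lambda>t. sqrt (2 * V t)) \<longlongrightarrow> sqrt (2 * l)) at_top"
    by (intro tendsto_intros)
  then have dist: "\<exists>l. ((\<lambda>t. norm ((x t, y t, lam t) - (\<xi>, \<psi>, \<eta>))) \<longlongrightarrow> l) at_top"
    by (auto simp: V_def u_def)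

  have cont: "continuous_on {0..} x" "continuous_on {0..} y" "continuous_on {0..} lam"
    using continuous_on_fst[OF cont_u] continuous_on_fst[OF continuous_on_snd[OF cont_u]]
      continuous_on_snd[OF continuous_on_snd[OF cont_u]]
    by (simp_all add: u_def)
  have cont_fg: "continuous_on UNIV f" "continuous_on UNIV g"
    using grad_f grad_g unfolding gderiv_def
    by (auto intro!: continuous_at_imp_continuous_on intro: has_derivative_continuous)
  have "continuous_on {0..} gap"
    unfolding gap_def Lagrangian_def
    by (intro continuous_intros cont A.continuous_on B.continuous_on
        continuous_on_compose2[OF cont_fg(1)] continuous_on_compose2[OF cont_fg(2)]) auto
  moreover have "continuous_on {0..} V'"
    unfolding V'_def by (intro continuous_intros cont_u cont_dot)
  ultimately have "set_integrable lborel {0..} gap"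
    using set_integrable_dissipation_rate[OF deriv_V] gap_nonneg gap_le l by blast
  with dist speed show "(\<exists>l. ((\<lambda>t. norm ((x t, y t, lam t) - (\<xi>, \<psi>, \<eta>))) \<longlongrightarrow> l) at_top) \<and>
      (\<exists>l. ((\<lambda>t. norm (dot x t, dot y t, dot lam t)) \<longlongrightarrow> l) at_top) \<and>
      set_integrable lborel {0..} (\<lambda>\<tau>. ?L (x \<tau>) (y \<tau>) \<eta> - ?L \<xi> \<psi> (lam \<tau>))"
    unfolding gap_def by blast
qed

end
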